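(* Let $X=\{X_1,\dots,X_m\}\subset\mathbb{Z}^2$ ($m\ge2$, repetitions allowed) span $\mathbb{R}^2$ and be $\eta$-coplanar, and let $Y=\{Y_1,\dots,Y_{m'}\}\subset\mathbb{Z}^2$ ($m'\ge2$) span $\mathbb{R}^2$ and be $\eta'$-coplanar, with $\eta,\eta'\in\mathbb{R}^2$. Suppose $X$ and $Y$ define the same directional growth function, i.e. $\mathbf{C}_X=\mathbf{C}_Y$ and $\gamma_X=\gamma_Y$. Then $\eta=c\eta'$ for some $c>0$; that is, the line containing $X$ and the line containing $Y$ are parallel.
   Context: A family $X$ is $\eta$-coplanar if $\langle\eta,X_j\rangle=1$ for all $j$. For a family $X$: $\mathbf{C}_X=X_1\mathbb{R}^++\dots+X_m\mathbb{R}^+$, $\mathcal{J}_X=X_1\mathbb{N}+\dots+X_m\mathbb{N}$ ($\mathbb{N}=\{0,1,\dots\}$); for $z\in\mathcal{J}_X$, $\mathbf{m}_X(z)$ is the number of finite words $i_1\cdots i_n$ ($i_k\in\{1,\dots,m\}$) with $X_{i_1}+\dots+X_{i_n}=z$; for $x\in\mathbf{C}_X$, $\mathbf{m}_X(x)=\min\{\mathbf{m}_X(z):z\in\mathcal{J}_X,\ \|x-z\|=d(x,\mathcal{J}_X)\}$ (Euclidean norm); $\gamma_X(\theta)=\lim_{k\to\infty}\frac{\log\mathbf{m}_X(k\theta)}{k}$ for unit $\theta\in\mathbf{C}_X$ (this limit exists). Same for $Y$. *)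

theory Defs
  imports "HOL-Analysis.Analysis"
begin

text \<open>
  A family \<open>X\<^sub>1, \<dots>, X\<^sub>m\<close> (repetitions allowed) is given by its length \<open>m\<close> and a function
  \<open>X\<close> of which only the values on \<open>{1..m}\<close> matter.
\<close>

definition integral_family :: "nat \<Rightarrow> (nat \<Rightarrow> real^2) \<Rightarrow> bool" where
  "integral_family m X \<longleftrightarrow> (\<forall>i\<in>{1..m}. \<forall>j. X i $ j \<in> \<int>)"

definition coplanar_family :: "real^2 \<Rightarrow> nat \<Rightarrow> (nat \<Rightarrow> real^2) \<Rightarrow> bool" where
  "coplanar_family \<eta> m X \<longleftrightarrow> (\<forall>i\<in>{1..m}. \<eta> \<bullet> X i = 1)"

definition family_cone :: "nat \<Rightarrow> (nat \<Rightarrow> real^2) \<Rightarrow> (real^2) set" where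
  "family_cone m X = {(\<Sum>i=1..m. t i *\<^sub>R X i) | t :: nat \<Rightarrow> real. \<forall>i\<in>{1..m}. 0 \<le> t i}"

definition family_monoid :: "nat \<Rightarrow> (nat \<Rightarrow> real^2) \<Rightarrow> (real^2) set" where
  "family_monoid m X = {(\<Sum>i=1..m. real (n i) *\<^sub>R X i) | n :: nat \<Rightarrow> nat. True}"

text \<open>
  Words are lists of indices, the empty word included. For a coplanar family a word with sum \<open>z\<close>
  has length \<open>\<eta> \<bullet> z\<close>, so the set below is finite and \<^const>\<open>card\<close> is the true number.
\<close>

definition word_count :: "nat \<Rightarrow> (nat \<Rightarrow> real^2) \<Rightarrow> real^2 \<Rightarrow> nat" where
  "word_count m X z = card {w :: nat list. set w \<subseteq> {1..m} \<and> sum_list (map X w) = z}"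

text \<open>
  The infimum is over a nonempty set of naturals whenever \<open>X\<close> is integral (the monoid is then
  closed and the distance is attained), hence it is a minimum.
\<close>

definition growth_count :: "nat \<Rightarrow> (nat \<Rightarrow> real^2) \<Rightarrow> real^2 \<Rightarrow> nat" where
  "growth_count m X x =
     Inf {word_count m X z | z. z \<in> family_monoid m X \<and> norm (x - z) = infdist x (family_monoid m X)}"

definition directional_growth :: "nat \<Rightarrow> (nat \<Rightarrow> real^2) \<Rightarrow> real^2 \<Rightarrow> real" where
  "directional_growth m X \<theta> =
     lim (\<lambda>k::nat. ln (real (growth_count m X (real k *\<^sub>R \<theta>))) / real k)"

end

theory Submission
  imports
    Defs
    "HOL-Combinatorics.Multiset_Permutations"
    "HOL-Complex_Analysis.Conformal_Mappings"
    "HOL-Computational_Algebra.Fundamental_Theorem_Algebra"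
begin

text \<open>
  Let \<open>P\<^sub>X(u) = \<Sum>\<^sub>i exp (- \<langle>u, X\<^sub>i\<rangle>)\<close>. If \<open>P\<^sub>X(u) \<le> 1\<close> then \<open>\<gamma>\<^sub>X(\<theta>) \<le> \<langle>u, \<theta>\<rangle>\<close>, and equality
  holds if \<open>P\<^sub>X(u) = 1\<close> and \<open>\<theta>\<close> is a positive multiple of the mean \<open>\<Sum>\<^sub>i exp (- \<langle>u, X\<^sub>i\<rangle>) X\<^sub>i\<close>; every
  interior direction arises in this way. Hence \<open>\<gamma>\<^sub>X\<close> determines the set \<open>{P\<^sub>X \<le> 1}\<close>, and
  \<open>\<gamma>\<^sub>X = \<gamma>\<^sub>Y\<close> forces the curves \<open>P\<^sub>X = 1\<close> and \<open>P\<^sub>Y = 1\<close> to coincide.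

  Let \<open>E\<close>, \<open>F\<close> be the extreme vectors of \<open>X\<close> and \<open>\<Delta> = det(E, F)\<close>. Writing \<open>\<Delta> X\<^sub>i = a\<^sub>i E + b\<^sub>i F\<close> and
  \<open>\<Delta> Y\<^sub>j = \<alpha>\<^sub>j E + \<alpha>'\<^sub>j F\<close> with nonnegative integers, \<open>a\<^sub>i + b\<^sub>i = \<Delta>\<close>, the first curve can be
  parametrised by \<open>t > 0\<close>, and the second equation becomes \<open>\<Sum>\<^sub>j t\<^bsup>\<alpha>\<^sub>j\<^esup> Q(t)\<^bsup>-\<beta>\<^sub>j\<^esup> = 1\<close> with
  \<open>Q(t) = \<Sum>\<^sub>i t\<^bsup>a\<^sub>i\<^esup>\<close> and \<open>\<beta>\<^sub>j = (\<alpha>\<^sub>j + \<alpha>'\<^sub>j) / \<Delta>\<close>. If the two lines are not parallel, \<open>\<beta>\<^sub>j\<close> determines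
  \<open>\<alpha>\<^sub>j\<close>. Continue the identity analytically to the disc around \<open>0\<close> whose radius is the least modulus
  of a complex root of \<open>Q\<close>: at that root the terms with the largest \<open>\<beta>\<^sub>j\<close> blow up and cannot cancel.
\<close>

section \<open>Counting words\<close>

definition partition_sum :: "nat \<Rightarrow> (nat \<Rightarrow> real^2) \<Rightarrow> real^2 \<Rightarrow> real" where
  "partition_sum m X u = (\<Sum>i=1..m. exp (- (u \<bullet> X i)))"

text \<open>The weight \<open>exp (- (u \<bullet> sum))\<close> is multiplicative under
  concatenation, so the total over words of length \<open>n\<close> factorises letter by
  letter.\<close>

lemma sum_exp_words:
  fixes X :: "'b \<Rightarrow> 'a::real_inner"
  assumes "finite A"
  shows "(\<Sum>w | set w \<subseteq> A \<and> length w = n. exp (- (u \<bullet> sum_list (map X w)))) =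
    (\<Sum>i\<in>A. exp (- (u \<bullet> X i))) ^ n"
proof (induction n)
  case 0
  have "{w. set w \<subseteq> A \<and> length w = 0} = {[]}"
    by auto
  then show ?case
    by simp
next
  case (Suc n)
  let ?W = "{w. set w \<subseteq> A \<and> length w = n}"
  have "(\<Sum>w | set w \<subseteq> A \<and> length w = Suc n. exp (- (u \<bullet> sum_list (map X w)))) =
    (\<Sum>(w, i)\<in>?W \<times> A. exp (- (u \<bullet> sum_list (map X w))) * exp (- (u \<bullet> X i)))"
    unfolding lists_length_Suc_eq
    by (subst sum.reindex) (auto simp: inj_on_def inner_add_right mult_exp_exp intro!: sum.cong)
  also have "\<dots> = (\<Sum>w\<in>?W. exp (- (u \<bullet> sum_list (map X w)))) * (\<Sum>i\<in>A. exp (- (u \<bullet> X i)))"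
    by (simp add: sum_product sum.cartesian_product)
  finally show ?case
    by (simp add: Suc.IH)
qed

lemma inner_sum_list_coplanar:
  assumes "coplanar_family \<eta> m X" "set w \<subseteq> {1..m}"
  shows "\<eta> \<bullet> sum_list (map X w) = real (length w)"
  using assms(2) by (induction w) (use assms(1) in \<open>auto simp: coplanar_family_def inner_add_right\<close>)

text \<open>Pairing with \<eta> reads the length of a word off its sum. This makes the set of words
  counted at \<open>z\<close> finite; the floor only casts that length to
  \<open>nat\<close>.\<close>

lemma words_subset:
  assumes "coplanar_family \<eta> m X"
  shows "{w. set w \<subseteq> {1..m} \<and> sum_list (map X w) = z}
    \<subseteq> {w. set w \<subseteq> {1..m} \<and> length w = nat \<lfloor>\<eta> \<bullet> z\<rfloor>}"
  using inner_sum_list_coplanar[OF assms] by auto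

text \<open>A Chernoff bound: all words with sum \<open>z\<close> have the same weight
  \<open>exp (- (u \<bullet> z))\<close> and the same length \<open>n\<close>, and the total weight
  of the words of length \<open>n\<close> is the \<open>n\<close>-th power of the partition
  sum.\<close>

lemma word_count_le_exp:
  assumes cop: "coplanar_family \<eta> m X" and u: "partition_sum m X u \<le> 1"
  shows "real (word_count m X z) \<le> exp (u \<bullet> z)"
proof -
  let ?W = "{w. set w \<subseteq> {1..m} \<and> sum_list (map X w) = z}"
  let ?V = "{w. set w \<subseteq> {1..m} \<and> length w = nat \<lfloor>\<eta> \<bullet> z\<rfloor>}"
  have "real (word_count m X z) * exp (- (u \<bullet> z)) = (\<Sum>w\<in>?W. exp (- (u \<bullet> sum_list (map X w))))"
    by (simp add: word_count_def)
  also have "\<dots> \<le> (\<Sum>w\<in>?V. exp (- (u \<bullet> sum_list (map X w))))"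
    using words_subset[OF cop, of z] by (intro sum_mono2 finite_lists_length_eq) auto
  also have "\<dots> = partition_sum m X u ^ nat \<lfloor>\<eta> \<bullet> z\<rfloor>"
    unfolding partition_sum_def by (rule sum_exp_words) simp
  also have "\<dots> \<le> 1"
    using u by (intro power_le_one) (auto simp: partition_sum_def intro: sum_nonneg)
  finally show ?thesis
    by (simp add: exp_minus field_simps)
qed

lemma sum_mset_image_sum_replicate:
  fixes X :: "'b \<Rightarrow> 'a::real_vector"
  assumes "finite A"
  shows "sum_mset (image_mset X (\<Sum>i\<in>A. replicate_mset (n i) i)) = (\<Sum>i\<in>A. real (n i) *\<^sub>R X i)"
proof -
  have "sum_mset (image_mset X (replicate_mset k i)) = real k *\<^sub>R X i" for k i
    by (induction k) (auto simp: algebra_simps)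
  with assms show ?thesis
    by (induction A rule: finite_induct) auto
qed

text \<open>The arrangements of the multiset with \<open>n i\<close> copies of each index
  \<open>i\<close> are distinct words with the required sum, and the multinomial coefficient counts
  them.\<close>

lemma word_count_ge_multinomial:
  fixes n :: "nat \<Rightarrow> nat"
  assumes cop: "coplanar_family \<eta> m X"
  shows "fact (\<Sum>i=1..m. n i) / (\<Prod>i=1..m. fact (n i))
    \<le> real (word_count m X (\<Sum>i=1..m. real (n i) *\<^sub>R X i))"
proof -
  define M where "M = (\<Sum>i=1..m. replicate_mset (n i) i)"
  let ?z = "\<Sum>i=1..m. real (n i) *\<^sub>R X i"
  let ?W = "{w. set w \<subseteq> {1..m} \<and> sum_list (map X w) = ?z}"
  have count: "count M i = (if i \<in> {1..m} then n i else 0)" for i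
    unfolding M_def count_sum by (auto simp: if_distrib cong: if_cong)
  have size: "size M = (\<Sum>i=1..m. n i)"
    by (simp add: M_def size_multiset_sum)
  have set: "set_mset M \<subseteq> {1..m}"
    using count by (auto simp: set_mset_def split: if_splits)
  have "sum_list (map X w) = ?z" if "mset w = M" for w
  proof -
    have "sum_list (map X w) = sum_mset (image_mset X M)"
      using that by (metis mset_map sum_mset_sum_list)
    also have "\<dots> = ?z"
      unfolding M_def by (rule sum_mset_image_sum_replicate) simp
    finally show ?thesis .
  qed
  then have "permutations_of_multiset M \<subseteq> ?W"
    using set by (auto simp: permutations_of_multiset_def)
  moreover have "finite ?W"
    by (rule finite_subset[OF words_subset[OF cop]]) (rule finite_lists_length_eq, simp)
  ultimately have le: "card (permutations_of_multiset M) \<le> word_count m X ?z"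
    unfolding word_count_def by (intro card_mono)
  have "(\<Prod>x\<in>set_mset M. fact (count M x)) = (\<Prod>i=1..m. fact (n i) :: nat)"
    using set by (intro prod.mono_neutral_cong_left) (auto simp: count not_in_iff)
  then have "card (permutations_of_multiset M) * (\<Prod>i=1..m. fact (n i)) = fact (\<Sum>i=1..m. n i)"
    using card_permutations_of_multiset_aux[of M] by (simp add: size)
  from arg_cong[OF this, of real]
  have "real (card (permutations_of_multiset M)) * (\<Prod>i=1..m. fact (n i)) = fact (\<Sum>i=1..m. n i)"
    unfolding of_nat_mult of_nat_prod of_nat_fact .
  moreover have "(\<Prod>i=1..m. fact (n i) :: real) > 0"
    by (intro prod_pos) auto
  ultimately have "fact (\<Sum>i=1..m. n i) / (\<Prod>i=1..m. fact (n i)) = real (card (permutations_of_multiset M))"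
    by (simp add: field_simps)
  then show ?thesis
    using le by simp
qed

section \<open>Growth of factorials\<close>

text \<open>Together with \<open>ln_fact_le\<close> this is Stirling's formula up to an error
  \<open>ln n + 1\<close>, which vanishes after division by a scale comparable to
  \<open>n\<close>.\<close>

lemma ln_fact_ge: "real n * ln (real n) - real n \<le> ln (fact n)"
proof (induction n)
  case (Suc n)
  have "real n * (ln (real (Suc n)) - ln (real n)) \<le> 1"
  proof (cases "n = 0")
    case False
    then show ?thesis
      using ln_le_minus_one[of "real (Suc n) / real n"] by (simp add: ln_div field_simps)
  qed simp
  moreover have "ln (fact (Suc n)) = ln (real (Suc n)) + ln (fact n)"
    unfolding fact_Suc by (rule ln_mult_pos) auto
  ultimately show ?case
    using Suc by (simp add: algebra_simps del: fact_Suc)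
qed simp

lemma ln_fact_le: "n > 0 \<Longrightarrow> ln (fact n) \<le> real n * ln (real n) - real n + ln (real n) + 1"
proof (induction n rule: nat_induct_non_zero)
  case (Suc n)
  have "ln (real (Suc n)) - ln (real n) \<ge> 1 / real (Suc n)"
    using ln_le_minus_one[of "real n / real (Suc n)"] Suc by (simp add: ln_div field_simps)
  then have *: "(real n + 1) * (ln (real (Suc n)) - ln (real n)) \<ge> 1"
    by (simp add: field_simps)
  have "ln (fact (Suc n)) = ln (real (Suc n)) + ln (fact n)"
    unfolding fact_Suc by (rule ln_mult_pos) auto
  then show ?case
    using Suc * by (simp add: algebra_simps del: fact_Suc)
qed simp

text \<open>The correction terms use \<open>ln k\<close> instead of \<open>ln (f k)\<close>, so they
  are linear in \<open>f k\<close> and cancel in a multinomial coefficient, whose lower entries add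
  up to the upper one.\<close>

lemma ln_fact_asymptotic:
  fixes f :: "nat \<Rightarrow> nat"
  assumes lim: "(\<lambda>k. real (f k) / real k) \<longlonglongrightarrow> a" and a: "a > 0"
  shows "(\<lambda>k. (ln (fact (f k)) - real (f k) * ln (real k) + real (f k)) / real k) \<longlonglongrightarrow> a * ln a"
proof -
  have pos: "eventually (\<lambda>k. f k > 0 \<and> k > 0) sequentially"
    using order_tendstoD(1)[OF lim a] eventually_gt_at_top[of 0]
    by eventually_elim (auto simp: zero_less_divide_iff)
  define r where "r = (\<lambda>k. (ln (fact (f k)) - (real (f k) * ln (real (f k)) - real (f k))) / real k)"
  have "(\<lambda>k. real (f k) / real k * ln (real (f k) / real k)) \<longlonglongrightarrow> a * ln a"
    using lim a by (intro tendsto_intros) auto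
  moreover have "r \<longlonglongrightarrow> 0"
  proof (rule tendsto_sandwich)
    show "eventually (\<lambda>k. 0 \<le> r k) sequentially"
      using ln_fact_ge by (simp add: r_def)
    show "eventually (\<lambda>k. r k \<le> ln (real (f k) / real k) / real k + ln (real k) / real k + 1 / real k) sequentially"
      using pos
    proof eventually_elim
      case (elim k)
      then have "r k \<le> (ln (real (f k)) + 1) / real k"
        unfolding r_def using ln_fact_le[of "f k"] by (intro divide_right_mono) auto
      also have "\<dots> = ln (real (f k) / real k) / real k + ln (real k) / real k + 1 / real k"
        using elim by (simp add: ln_div field_simps)
      finally show ?case .
    qed
    have "(\<lambda>k. ln (real (f k) / real k) * (1 / real k) + ln (real k) / real k + 1 / real k) \<longlonglongrightarrow> ln a * 0 + 0 + 0"
      using lim a lim_ln_over_n by (intro tendsto_intros lim_1_over_n) auto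
    then show "(\<lambda>k. ln (real (f k) / real k) / real k + ln (real k) / real k + 1 / real k) \<longlonglongrightarrow> 0"
      by simp
  qed simp
  ultimately have "(\<lambda>k. real (f k) / real k * ln (real (f k) / real k) + r k) \<longlonglongrightarrow> a * ln a + 0"
    by (intro tendsto_add)
  moreover have "eventually (\<lambda>k. real (f k) / real k * ln (real (f k) / real k) + r k =
     (ln (fact (f k)) - real (f k) * ln (real k) + real (f k)) / real k) sequentially"
    using pos by eventually_elim (simp add: r_def ln_div field_simps)
  ultimately show ?thesis
    using Lim_transform_eventually by force
qed

section \<open>The growth rate along Gibbs directions\<close>

lemma finite_bounded_integral_vectors:
  "finite {x :: real^'n. (\<forall>j. x $ j \<in> \<int>) \<and> norm x \<le> R}"
proof (rule finite_subset)
  let ?F = "(UNIV :: 'n set) \<rightarrow>\<^sub>E {-\<lceil>R\<rceil>..\<lceil>R\<rceil>}"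
  show "{x :: real^'n. (\<forall>j. x $ j \<in> \<int>) \<and> norm x \<le> R} \<subseteq> (\<lambda>f. \<chi> j. of_int (f j)) ` ?F"
  proof safe
    fix x :: "real^'n" assume x: "\<forall>j. x $ j \<in> \<int>" "norm x \<le> R"
    have "\<lfloor>x $ j\<rfloor> \<in> {-\<lceil>R\<rceil>..\<lceil>R\<rceil>}" for j
    proof -
      have "\<bar>x $ j\<bar> \<le> R"
        using component_le_norm_cart[of x j] x by simp
      then show ?thesis
        by (auto simp: le_floor_iff floor_le_iff) linarith+
    qed
    moreover have "x = (\<chi> j. of_int \<lfloor>x $ j\<rfloor>)"
      using x(1) by (simp add: vec_eq_iff)
    ultimately show "x \<in> (\<lambda>f. \<chi> j. of_int (f j)) ` ?F"
      by (intro image_eqI[of _ _ "\<lambda>j. \<lfloor>x $ j\<rfloor>"]) auto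
  qed
qed (intro finite_imageI finite_PiE, auto)

lemma integral_combination:
  assumes "integral_family m X"
  shows "(\<Sum>i=1..m. of_int (c i) *\<^sub>R X i) $ j \<in> \<int>"
  unfolding sum_component vector_scaleR_component
  using assms by (intro Ints_sum) (auto simp: integral_family_def)

text \<open>Only finitely many integral vectors have norm at most \<open>R\<close>, so one
  representation fixed for each representable one gives a uniform bound. It serves to correct a
  rounded combination so that it hits a prescribed nearby lattice point.\<close>

lemma bounded_integer_coefficients:
  assumes int: "integral_family m X"
  shows "\<exists>K. \<forall>c :: nat \<Rightarrow> int. norm (\<Sum>i=1..m. of_int (c i) *\<^sub>R X i) \<le> R \<longrightarrow>
    (\<exists>c' :: nat \<Rightarrow> int. (\<Sum>i=1..m. of_int (c' i) *\<^sub>R X i) = (\<Sum>i=1..m. of_int (c i) *\<^sub>R X i)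
      \<and> (\<forall>i\<in>{1..m}. \<bar>real_of_int (c' i)\<bar> \<le> K))"
proof -
  define comb where "comb = (\<lambda>c :: nat \<Rightarrow> int. \<Sum>i=1..m. of_int (c i) *\<^sub>R X i)"
  define S where "S = range comb \<inter> {x. norm x \<le> R}"
  \<comment> \<open>The chosen coefficients depend only on the value of the combination, not on the
    given representation.\<close>
  define c' where "c' = inv comb"
  define K where "K = (\<Sum>x\<in>S. \<Sum>i=1..m. \<bar>real_of_int (c' x i)\<bar>)"
  have "finite S"
  proof (rule finite_subset[OF _ finite_bounded_integral_vectors[of R]], rule subsetI)
    fix x assume "x \<in> S"
    then obtain c where "x = comb c" "norm x \<le> R"
      by (auto simp: S_def)
    then show "x \<in> {x. (\<forall>j. x $ j \<in> \<int>) \<and> norm x \<le> R}"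
      using integral_combination[OF int, of c] by (simp add: comb_def)
  qed
  have "\<bar>real_of_int (c' (comb c) i)\<bar> \<le> K" if c: "norm (comb c) \<le> R" and i: "i \<in> {1..m}" for c i
  proof -
    have "\<bar>real_of_int (c' (comb c) i)\<bar> \<le> (\<Sum>i=1..m. \<bar>real_of_int (c' (comb c) i)\<bar>)"
      using i by (intro member_le_sum) auto
    also have "\<dots> \<le> K"
      unfolding K_def using c \<open>finite S\<close> by (intro member_le_sum) (auto simp: S_def intro!: sum_nonneg)
    finally show ?thesis .
  qed
  moreover have "comb (c' (comb c)) = comb c" for c
    by (simp add: c'_def f_inv_into_f)
  ultimately show ?thesis
    unfolding comb_def by blast
qed

lemma closed_family_monoid:
  assumes "integral_family m X"
  shows "closed (family_monoid m X)"
proof (rule discrete_imp_closed[of 1]; safe?)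
  fix x y assume x: "x \<in> family_monoid m X" and y: "y \<in> family_monoid m X" and d: "dist y x < 1"
  have int: "x $ j \<in> \<int>" if x: "x \<in> family_monoid m X" for x j
  proof -
    obtain n where "x = (\<Sum>i=1..m. real (n i) *\<^sub>R X i)"
      using x by (auto simp: family_monoid_def)
    then show ?thesis
      using integral_combination[OF assms, of "\<lambda>i. int (n i)" j] by simp
  qed
  have "y $ j = x $ j" for j
  proof -
    have "\<bar>y $ j - x $ j\<bar> < 1"
      using component_le_norm_cart[of "y - x" j] d by (simp add: dist_norm)
    moreover have "y $ j - x $ j \<in> \<int>"
      using int[OF x] int[OF y] by simp
    ultimately show ?thesis
      by (metis Ints_nonzero_abs_less1 right_minus_eq)
  qed
  then show "y = x"
    by (simp add: vec_eq_iff)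
qed simp

text \<open>The monoid is closed, so a nearest point exists; hence the \<open>Inf\<close> runs over
  a nonempty set of naturals and belongs to it.\<close>

lemma growth_count_attained:
  assumes "integral_family m X"
  obtains z where "z \<in> family_monoid m X" "norm (x - z) = infdist x (family_monoid m X)"
    "growth_count m X x = word_count m X z"
proof -
  let ?M = "family_monoid m X"
  let ?S = "{word_count m X z | z. z \<in> ?M \<and> norm (x - z) = infdist x ?M}"
  have ne: "?M \<noteq> {}"
    by (auto simp: family_monoid_def)
  obtain z where z: "z \<in> ?M" "\<And>y. y \<in> ?M \<Longrightarrow> dist x z \<le> dist x y"
    using distance_attains_inf[OF closed_family_monoid[OF assms] ne] by blast
  have "infdist x ?M = dist x z"
    using z ne by (intro antisym infdist_le) (auto simp: infdist_notempty intro!: cINF_greatest)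
  then have "?S \<noteq> {}"
    using z(1) by (auto simp: dist_norm)
  then have "Inf ?S \<in> ?S"
    by (rule Inf_nat_def1)
  then show thesis
    using that by (auto simp: growth_count_def)
qed

text \<open>Rounding the cone coefficients down yields a monoid point. The bound is independent of
  \<open>x\<close>, so nearest points stay within bounded distance along a whole ray.\<close>

lemma infdist_family_monoid_le:
  assumes "x \<in> family_cone m X"
  shows "infdist x (family_monoid m X) \<le> (\<Sum>i=1..m. norm (X i))"
proof -
  obtain t where x: "x = (\<Sum>i=1..m. t i *\<^sub>R X i)" and t: "\<forall>i\<in>{1..m}. 0 \<le> t i"
    using assms by (auto simp: family_cone_def)
  define z where "z = (\<Sum>i=1..m. real (nat \<lfloor>t i\<rfloor>) *\<^sub>R X i)"
  have "z \<in> family_monoid m X"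
    unfolding family_monoid_def z_def by (rule CollectI, rule exI[of _ "\<lambda>i. nat \<lfloor>t i\<rfloor>"]) simp
  moreover have "dist x z = norm (\<Sum>i=1..m. (t i - real (nat \<lfloor>t i\<rfloor>)) *\<^sub>R X i)"
    by (simp add: dist_norm x z_def sum_subtractf scaleR_left_diff_distrib)
  moreover have "\<dots> \<le> (\<Sum>i=1..m. norm (X i))"
  proof (rule sum_norm_le)
    fix i assume "i \<in> {1..m}"
    then have "\<bar>t i - real (nat \<lfloor>t i\<rfloor>)\<bar> \<le> 1"
      using t by (simp add: of_nat_nat) linarith
    then show "norm ((t i - real (nat \<lfloor>t i\<rfloor>)) *\<^sub>R X i) \<le> norm (X i)"
      by (simp add: mult_left_le_one_le)
  qed
  ultimately show ?thesis
    by (intro infdist_le2) auto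
qed

lemma tendsto_divide_of_bounded_error:
  fixes f :: "nat \<Rightarrow> 'a::real_normed_vector"
  assumes "\<And>k. norm (real k *\<^sub>R a - f k) \<le> C"
  shows "(\<lambda>k. f k /\<^sub>R real k) \<longlonglongrightarrow> a"
proof -
  have "(\<lambda>k. C * (1 / real k)) \<longlonglongrightarrow> C * 0"
    by (intro tendsto_intros lim_1_over_n)
  then have "(\<lambda>k. C / real k) \<longlonglongrightarrow> 0"
    by simp
  moreover have "eventually (\<lambda>k. norm (f k /\<^sub>R real k - a) \<le> C / real k) sequentially"
    using eventually_gt_at_top[of 0]
  proof eventually_elim
    case (elim k)
    then have "f k /\<^sub>R real k - a = (f k - real k *\<^sub>R a) /\<^sub>R real k"
      by (simp add: scaleR_diff_right)
    then have "norm (f k /\<^sub>R real k - a) = norm (f k - real k *\<^sub>R a) / real k"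
      by (simp add: divide_inverse_commute)
    also have "\<dots> \<le> C / real k"
      using assms[of k] by (intro divide_right_mono) (auto simp: norm_minus_commute)
    finally show ?case .
  qed
  ultimately have "(\<lambda>k. f k /\<^sub>R real k - a) \<longlonglongrightarrow> 0"
    by (rule Lim_null_comparison[rotated])
  then show ?thesis
    by (simp add: LIM_zero_iff)
qed

text \<open>The upper bound is \<open>word_count_le_exp\<close> at the nearest point. For the lower
  bound, words using letter \<open>i\<close> about \<open>k * c * q i\<close> times give a
  multinomial coefficient whose exponential rate, an entropy, is exactly
  \<open>u \<bullet> \<theta>\<close>.\<close>

lemma growth_limit:
  assumes int: "integral_family m X" and cop: "coplanar_family \<eta> m X"
    and u: "partition_sum m X u = 1" and c: "c > 0"
    and \<theta>: "\<theta> = c *\<^sub>R (\<Sum>i=1..m. exp (- (u \<bullet> X i)) *\<^sub>R X i)"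
  shows "(\<lambda>k. ln (real (growth_count m X (real k *\<^sub>R \<theta>))) / real k) \<longlonglongrightarrow> u \<bullet> \<theta>"
proof -
  define q where "q = (\<lambda>i. exp (- (u \<bullet> X i)))"
  have q_pos: "q i > 0" for i
    by (simp add: q_def)
  have q_sum: "(\<Sum>i=1..m. q i) = 1"
    using u by (simp add: q_def partition_sum_def)
  have \<theta>_eq: "\<theta> = (\<Sum>i=1..m. (c * q i) *\<^sub>R X i)"
    by (simp add: \<theta> q_def scaleR_sum_right)
  define D where "D = (\<Sum>i=1..m. norm (X i))"
  have "\<exists>z. z \<in> family_monoid m X \<and> norm (real k *\<^sub>R \<theta> - z) \<le> D
      \<and> growth_count m X (real k *\<^sub>R \<theta>) = word_count m X z" for k
  proof -
    have "real k *\<^sub>R \<theta> = (\<Sum>i=1..m. (real k * c * q i) *\<^sub>R X i)"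
      by (simp add: \<theta>_eq scaleR_sum_right mult.assoc)
    then have "real k *\<^sub>R \<theta> \<in> family_cone m X"
      unfolding family_cone_def using c q_pos
      by (intro CollectI exI[of _ "\<lambda>i. real k * c * q i"]) (auto simp: less_imp_le)
    from infdist_family_monoid_le[OF this] show ?thesis
      using growth_count_attained[OF int, of "real k *\<^sub>R \<theta>"] unfolding D_def by metis
  qed
  then obtain z where z: "\<And>k. z k \<in> family_monoid m X" "\<And>k. norm (real k *\<^sub>R \<theta> - z k) \<le> D"
    and gc: "\<And>k. growth_count m X (real k *\<^sub>R \<theta>) = word_count m X (z k)"
    by metis
  obtain K where K: "\<And>b :: nat \<Rightarrow> int. norm (\<Sum>i=1..m. of_int (b i) *\<^sub>R X i) \<le> D + D \<Longrightarrow>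
    \<exists>c' :: nat \<Rightarrow> int. (\<Sum>i=1..m. of_int (c' i) *\<^sub>R X i) = (\<Sum>i=1..m. of_int (b i) *\<^sub>R X i)
      \<and> (\<forall>i\<in>{1..m}. \<bar>real_of_int (c' i)\<bar> \<le> K)"
    using bounded_integer_coefficients[OF int, of "D + D"] by blast
  \<comment> \<open>The words must sum to the nearest point \<open>z k\<close> itself, which the
    rounded combination may miss. The difference is an integer combination of norm at most
    \<open>D + D\<close>, so it can be absorbed by coefficients bounded by \<open>K\<close>; the
    extra 1 is the rounding error.\<close>
  have "\<exists>\<nu> :: nat \<Rightarrow> int. (\<Sum>i=1..m. of_int (\<nu> i) *\<^sub>R X i) = z k
      \<and> (\<forall>i\<in>{1..m}. \<bar>real k * (c * q i) - real_of_int (\<nu> i)\<bar> \<le> K + 1)" for k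
  proof -
    define fl where "fl = (\<lambda>i. \<lfloor>real k * (c * q i)\<rfloor>)"
    obtain a :: "nat \<Rightarrow> nat" where a: "z k = (\<Sum>i=1..m. real (a i) *\<^sub>R X i)"
      using z(1)[of k] by (auto simp: family_monoid_def)
    define b where "b = (\<lambda>i. int (a i) - fl i)"
    have b: "(\<Sum>i=1..m. of_int (b i) *\<^sub>R X i) = z k - (\<Sum>i=1..m. of_int (fl i) *\<^sub>R X i)"
      by (simp add: b_def a scaleR_left_diff_distrib sum_subtractf)
    have "norm (real k *\<^sub>R \<theta> - (\<Sum>i=1..m. of_int (fl i) *\<^sub>R X i))
        = norm (\<Sum>i=1..m. (real k * (c * q i) - of_int (fl i)) *\<^sub>R X i)"
      by (simp add: \<theta>_eq scaleR_sum_right sum_subtractf scaleR_left_diff_distrib)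
    also have "\<dots> \<le> D"
      unfolding D_def
    proof (rule sum_norm_le)
      fix i
      have "\<bar>real k * (c * q i) - of_int (fl i)\<bar> \<le> 1"
        unfolding fl_def by linarith
      then show "norm ((real k * (c * q i) - of_int (fl i)) *\<^sub>R X i) \<le> norm (X i)"
        by (simp add: mult_left_le_one_le)
    qed
    finally have "norm (\<Sum>i=1..m. of_int (b i) *\<^sub>R X i) \<le> D + D"
      using norm_triangle_ineq4[of "real k *\<^sub>R \<theta> - (\<Sum>i=1..m. of_int (fl i) *\<^sub>R X i)" "real k *\<^sub>R \<theta> - z k"]
        z(2)[of k] unfolding b by simp
    then obtain c' where c': "(\<Sum>i=1..m. of_int (c' i) *\<^sub>R X i) = (\<Sum>i=1..m. of_int (b i) *\<^sub>R X i)"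
      "\<forall>i\<in>{1..m}. \<bar>real_of_int (c' i)\<bar> \<le> K"
      using K by blast
    show ?thesis
    proof (intro exI[of _ "\<lambda>i. fl i + c' i"] conjI ballI)
      show "(\<Sum>i=1..m. of_int (fl i + c' i) *\<^sub>R X i) = z k"
        using c'(1) b by (simp add: scaleR_left_distrib sum.distrib)
      show "\<bar>real k * (c * q i) - real_of_int (fl i + c' i)\<bar> \<le> K + 1" if "i \<in> {1..m}" for i
        using c'(2)[rule_format, OF that] unfolding fl_def of_int_add by linarith
    qed
  qed
  then obtain \<nu> :: "nat \<Rightarrow> nat \<Rightarrow> int"
    where \<nu>: "\<And>k. (\<Sum>i=1..m. of_int (\<nu> k i) *\<^sub>R X i) = z k"
    and \<nu>_bound: "\<And>k i. i \<in> {1..m} \<Longrightarrow> \<bar>real k * (c * q i) - real_of_int (\<nu> k i)\<bar> \<le> K + 1"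
    by metis
  have \<nu>_lim: "(\<lambda>k. real_of_int (\<nu> k i) / real k) \<longlonglongrightarrow> c * q i" if "i \<in> {1..m}" for i
    using tendsto_divide_of_bounded_error[of "c * q i" "\<lambda>k. real_of_int (\<nu> k i)" "K + 1"] \<nu>_bound[OF that]
    by (simp add: divide_inverse_commute)
  \<comment> \<open>Every Gibbs weight is strictly positive, so the main term outgrows the bounded
    correction and \<nu> eventually consists of genuine letter multiplicities.\<close>
  have ev: "eventually (\<lambda>k. \<forall>i\<in>{1..m}. \<nu> k i > 0) sequentially"
  proof (intro eventually_ball_finite ballI)
    fix i assume "i \<in> {1..m}"
    from order_tendstoD(1)[OF \<nu>_lim[OF this], of 0] show "eventually (\<lambda>k. \<nu> k i > 0) sequentially"
      using c q_pos by (auto elim!: eventually_mono simp: zero_less_divide_iff)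
  qed simp
  define n where "n = (\<lambda>k i. nat (\<nu> k i))"
  define N where "N = (\<lambda>k. \<Sum>i=1..m. n k i)"
  have n_lim: "(\<lambda>k. real (n k i) / real k) \<longlonglongrightarrow> c * q i" if "i \<in> {1..m}" for i
    using \<nu>_lim[OF that]
  proof (rule Lim_transform_eventually)
    show "eventually (\<lambda>k. real_of_int (\<nu> k i) / real k = real (n k i) / real k) sequentially"
      using ev
    proof eventually_elim
      case (elim k)
      then have "\<nu> k i > 0"
        using that by blast
      then show ?case
        by (simp add: n_def)
    qed
  qed
  have "(\<lambda>k. \<Sum>i=1..m. real (n k i) / real k) \<longlonglongrightarrow> (\<Sum>i=1..m. c * q i)"
    by (intro tendsto_sum n_lim)
  then have N_lim: "(\<lambda>k. real (N k) / real k) \<longlonglongrightarrow> c"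
    using q_sum by (simp add: N_def sum_divide_distrib flip: sum_distrib_left)
  define A where "A = (\<lambda>k n. (ln (fact n) - real n * ln (real k) + real n) / real k)"
  have "(\<lambda>k. A k (N k) - (\<Sum>i=1..m. A k (n k i))) \<longlonglongrightarrow> c * ln c - (\<Sum>i=1..m. (c * q i) * ln (c * q i))"
    unfolding A_def using c q_pos
    by (intro tendsto_diff tendsto_sum ln_fact_asymptotic n_lim N_lim) auto
  \<comment> \<open>Since \<open>ln (c * q i) = ln c - u \<bullet> X i\<close>, the entropy is
    affine in \<open>X i\<close>; the parts with \<open>ln c\<close> cancel because the weights sum
    to 1.\<close>
  also have "(\<Sum>i=1..m. (c * q i) * ln (c * q i)) = (\<Sum>i=1..m. c * ln c * q i - u \<bullet> ((c * q i) *\<^sub>R X i))"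
    using c by (intro sum.cong refl) (simp add: q_def ln_mult_pos algebra_simps)
  also have "c * ln c - \<dots> = u \<bullet> \<theta>"
    unfolding sum_subtractf \<theta>_eq inner_sum_right sum_distrib_left[symmetric] q_sum by simp
  finally have lower_lim: "(\<lambda>k. A k (N k) - (\<Sum>i=1..m. A k (n k i))) \<longlonglongrightarrow> u \<bullet> \<theta>" .
  have multinomial: "eventually (\<lambda>k. fact (N k) / (\<Prod>i=1..m. fact (n k i)) \<le> real (word_count m X (z k))) sequentially"
    using ev
  proof eventually_elim
    case (elim k)
    then have "(\<Sum>i=1..m. real (n k i) *\<^sub>R X i) = (\<Sum>i=1..m. of_int (\<nu> k i) *\<^sub>R X i)"
      by (intro sum.cong refl) (simp add: n_def order_less_imp_le)
    then show ?case
      using word_count_ge_multinomial[OF cop, of "n k"] \<nu>[of k] by (simp add: N_def)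
  qed
  have mult_pos: "fact (N k) / (\<Prod>i=1..m. fact (n k i)) > (0::real)" for k
    by (intro divide_pos_pos prod_pos) auto
  show ?thesis
    unfolding gc
  proof (rule tendsto_sandwich[OF _ _ lower_lim])
    show "eventually (\<lambda>k. A k (N k) - (\<Sum>i=1..m. A k (n k i)) \<le> ln (real (word_count m X (z k))) / real k) sequentially"
      using multinomial
    proof eventually_elim
      case (elim k)
      have "A k (N k) - (\<Sum>i=1..m. A k (n k i)) = (ln (fact (N k)) - (\<Sum>i=1..m. ln (fact (n k i)))) / real k"
        unfolding A_def N_def
        by (simp add: sum.distrib sum_subtractf add_divide_distrib diff_divide_distrib
            flip: sum_divide_distrib sum_distrib_right)
      also have "ln (fact (N k)) - (\<Sum>i=1..m. ln (fact (n k i))) = ln (fact (N k) / (\<Prod>i=1..m. fact (n k i)) :: real)"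
        by (subst ln_div) (auto intro!: prod_pos simp: ln_prod)
      also have "\<dots> \<le> ln (real (word_count m X (z k)))"
        using elim mult_pos[of k] by (subst ln_le_cancel_iff) auto
      finally show ?case
        by (simp add: divide_right_mono)
    qed
    show "eventually (\<lambda>k. ln (real (word_count m X (z k))) / real k \<le> u \<bullet> (z k /\<^sub>R real k)) sequentially"
      using multinomial
    proof eventually_elim
      case (elim k)
      then have "real (word_count m X (z k)) > 0"
        using mult_pos[of k] by linarith
      then have "ln (real (word_count m X (z k))) \<le> ln (exp (u \<bullet> z k))"
        using word_count_le_exp[OF cop, of u "z k"] u by (subst ln_le_cancel_iff) auto
      then have "ln (real (word_count m X (z k))) \<le> u \<bullet> z k"
        by simp
      then show ?case
        by (simp add: divide_inverse_commute mult_left_mono)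
    qed
    show "(\<lambda>k. u \<bullet> (z k /\<^sub>R real k)) \<longlonglongrightarrow> u \<bullet> \<theta>"
      by (intro tendsto_intros tendsto_divide_of_bounded_error[OF z(2)])
  qed
qed

section \<open>Planar linear algebra and cones\<close>

definition det2 :: "real^2 \<Rightarrow> real^2 \<Rightarrow> real" where
  "det2 x y = x $ 1 * y $ 2 - x $ 2 * y $ 1"

definition perp :: "real^2 \<Rightarrow> real^2" where
  "perp x = vector [- (x $ 2), x $ 1]"

lemma inner_2: "(x :: real^2) \<bullet> y = x $ 1 * y $ 1 + x $ 2 * y $ 2"
  by (simp add: inner_vec_def sum_2)

lemma inner_perp: "perp x \<bullet> y = det2 x y"
  by (simp add: perp_def inner_2 det2_def)

lemma det2_commute: "det2 y x = - det2 x y"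
  by (simp add: det2_def)

lemma det2_self [simp]: "det2 x x = 0"
  by (simp add: det2_def)

lemma inner_perp_self [simp]: "x \<bullet> perp x = 0"
  by (simp add: inner_2 perp_def)

lemma det2_perp [simp]: "det2 x (perp x) = x \<bullet> x"
  by (simp add: inner_2 perp_def det2_def)

text \<open>For \<open>z = \<eta>\<close> and coplanar \<open>x\<close>, \<open>y\<close> both inner
  products on the right are 1, so the orientation of \<open>x\<close>, \<open>y\<close> is decided
  by their order along the line.\<close>

lemma det2_via_inner: "(z \<bullet> z) * det2 x y = (z \<bullet> x) * det2 z y - (z \<bullet> y) * det2 z x"
  by (simp add: inner_2 det2_def) algebra

text \<open>Cramer's rule for \<open>x\<close> in terms of \<open>e\<close> and \<open>f\<close>,
  cleared of denominators and paired with \<open>w\<close>.\<close>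

lemma Cramer2: "det2 e f * (w \<bullet> x) = det2 x f * (w \<bullet> e) + det2 e x * (w \<bullet> f)"
  by (simp add: inner_2 det2_def) algebra

lemma inner_eq_0_of_span:
  assumes "span S = UNIV" "\<And>x. x \<in> S \<Longrightarrow> w \<bullet> x = 0"
  shows "w = 0"
proof -
  have "span S \<subseteq> {x. w \<bullet> x = 0}"
    using assms(2) by (intro span_minimal subspace_hyperplane) auto
  then have "w \<in> {x. w \<bullet> x = 0}"
    using assms(1) by blast
  then show ?thesis
    by simp
qed

lemma family_cone_inner_nonneg:
  assumes "\<And>i. i \<in> {1..m} \<Longrightarrow> w \<bullet> X i \<ge> 0" "x \<in> family_cone m X"
  shows "w \<bullet> x \<ge> 0"
  using assms by (auto simp: family_cone_def inner_sum_right intro!: sum_nonneg)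

lemma mem_family_cone:
  assumes "i \<in> {1..m}"
  shows "X i \<in> family_cone m X"
proof -
  have "(\<Sum>j=1..m. (if j = i then 1 else 0) *\<^sub>R X j) = X i"
    using assms by (simp add: if_distrib[of "\<lambda>c. c *\<^sub>R _"] cong: if_cong)
  then show ?thesis
    unfolding family_cone_def by (intro CollectI exI[of _ "\<lambda>j. if j = i then 1 else 0"]) auto
qed

section \<open>Equal growth gives equal level sets\<close>

text \<open>The sum is the derivative of \<open>\<Sum> exp (d i * s)\<close>. As \<open>d\<close>
  takes both signs, this derivative is nonnegative far to the right and nonpositive far to the
  left.\<close>

lemma exists_critical_point:
  fixes d :: "'a \<Rightarrow> real"
  assumes "finite I" and a: "a \<in> I" "d a > 0" and b: "b \<in> I" "d b < 0"
  shows "\<exists>s. (\<Sum>i\<in>I. d i * exp (d i * s)) = 0"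
proof -
  have large: "\<exists>s\<ge>0. (\<Sum>i\<in>I. d i * exp (d i * s)) \<ge> 0" if a: "a \<in> I" "d a > 0" for d :: "'a \<Rightarrow> real" and a
  proof -
    define C where "C = (\<Sum>i\<in>I. \<bar>d i\<bar>)"
    \<comment> \<open>With this choice \<open>d a * exp (d a * s)\<close> is at least
      \<open>(d a)\<^sup>2 * s = C\<close>, enough to outweigh the other terms, each at least
      \<open>- \<bar>d i\<bar>\<close>.\<close>
    define s where "s = C / (d a)\<^sup>2"
    have "C \<ge> 0"
      by (auto simp: C_def intro: sum_nonneg)
    then have "s \<ge> 0"
      by (simp add: s_def)
    have "d a * (d a * s) \<le> d a * exp (d a * s)"
      using a exp_ge_add_one_self[of "d a * s"] by (intro mult_left_mono) linarith+
    then have "C \<le> d a * exp (d a * s)"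
      using a by (simp add: s_def power2_eq_square)
    moreover have "- \<bar>d i\<bar> \<le> d i * exp (d i * s)" for i
    proof (cases "d i \<ge> 0")
      case False
      then have "\<bar>d i\<bar> * exp (d i * s) \<le> \<bar>d i\<bar> * 1"
        using \<open>s \<ge> 0\<close> by (intro mult_left_mono) (auto simp: mult_le_0_iff)
      then show ?thesis
        using False by simp
    qed (simp add: order_trans[of _ 0])
    then have "(\<Sum>i\<in>I-{a}. - \<bar>d i\<bar>) \<le> (\<Sum>i\<in>I-{a}. d i * exp (d i * s))"
      by (intro sum_mono) auto
    moreover have "(\<Sum>i\<in>I-{a}. - \<bar>d i\<bar>) = - (C - \<bar>d a\<bar>)"
      using a \<open>finite I\<close> by (simp add: C_def sum_negf sum_diff1)
    moreover have "(\<Sum>i\<in>I. d i * exp (d i * s)) = d a * exp (d a * s) + (\<Sum>i\<in>I-{a}. d i * exp (d i * s))"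
      using a \<open>finite I\<close> by (simp add: sum.remove)
    ultimately show ?thesis
      using \<open>s \<ge> 0\<close> a by (intro exI[of _ s]) linarith
  qed
  obtain s1 where s1: "s1 \<ge> 0" "(\<Sum>i\<in>I. d i * exp (d i * s1)) \<ge> 0"
    using large[of a d, OF a] by blast
  obtain s2 where s2: "s2 \<ge> 0" "(\<Sum>i\<in>I. - d i * exp (- d i * s2)) \<ge> 0"
    using large[of b "\<lambda>i. - d i"] b by auto
  have "\<exists>s\<ge>-s2. s \<le> s1 \<and> (\<Sum>i\<in>I. d i * exp (d i * s)) = 0"
    using s1 s2 by (intro IVT') (auto simp: sum_negf intro!: continuous_intros)
  then show ?thesis
    by blast
qed

lemma partition_sum_shift:
  assumes "coplanar_family \<eta> m X"
  shows "partition_sum m X (u + s *\<^sub>R \<eta>) = exp (- s) * partition_sum m X u"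
  using assms unfolding partition_sum_def sum_distrib_left coplanar_family_def
  by (intro sum.cong refl) (simp add: inner_add_left mult_exp_exp)

lemma partition_sum_pos: "m \<ge> 1 \<Longrightarrow> partition_sum m X u > 0"
  unfolding partition_sum_def by (intro sum_pos) auto

lemma partition_sum_normalise:
  assumes "m \<ge> 1" "coplanar_family \<eta> m X"
  shows "partition_sum m X (u + ln (partition_sum m X u) *\<^sub>R \<eta>) = 1"
  using partition_sum_shift[OF assms(2)] partition_sum_pos[OF assms(1), of X u]
  by (simp add: exp_minus)

text \<open>The last assumption says that \<theta> lies in the interior of the cone. The direction
  of the Gibbs mean is adjusted by moving \<open>u\<close> along \<open>perp \<eta>\<close>, and the
  partition sum is then normalised by moving along \<eta>, which rescales all weights
  equally.\<close>

lemma exists_gibbs_vector: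
  assumes m: "m \<ge> 1" and cop: "coplanar_family \<eta> m X" and \<theta>: "\<eta> \<bullet> \<theta> > 0"
    and interior: "\<And>w. \<lbrakk>\<And>i. i \<in> {1..m} \<Longrightarrow> w \<bullet> X i \<ge> 0; w \<bullet> \<theta> = 0\<rbrakk> \<Longrightarrow> w = 0"
  obtains u where "partition_sum m X u = 1"
    "\<theta> = (\<eta> \<bullet> \<theta>) *\<^sub>R (\<Sum>i=1..m. exp (- (u \<bullet> X i)) *\<^sub>R X i)"
proof -
  \<comment> \<open>This value makes \<open>w\<close> orthogonal to \<theta>. By interiority neither
    \<open>w\<close> nor \<open>- w\<close> is nonnegative on the family, so \<open>d\<close> takes
    both signs.\<close>
  define \<kappa> where "\<kappa> = det2 \<eta> \<theta> / (\<eta> \<bullet> \<theta>)"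
  define w where "w = \<kappa> *\<^sub>R \<eta> - perp \<eta>"
  have cop': "\<eta> \<bullet> X i = 1" if "i \<in> {1..m}" for i
    using cop that by (auto simp: coplanar_family_def)
  have "\<eta> \<noteq> 0"
    using \<theta> by auto
  have w_inner: "w \<bullet> x = \<kappa> * (\<eta> \<bullet> x) - det2 \<eta> x" for x
    by (simp add: w_def inner_diff_left inner_perp)
  have w_\<theta>: "w \<bullet> \<theta> = 0"
    using \<theta> by (simp add: w_inner \<kappa>_def)
  have "w \<bullet> perp \<eta> = - (\<eta> \<bullet> \<eta>)"
    by (simp add: w_inner)
  then have "w \<noteq> 0"
    using \<open>\<eta> \<noteq> 0\<close> by auto
  define d where "d = (\<lambda>i. det2 \<eta> (X i) - \<kappa>)"
  have d: "d i = - (w \<bullet> X i)" if "i \<in> {1..m}" for i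
    using cop'[OF that] by (simp add: d_def w_inner)
  obtain a where a: "a \<in> {1..m}" "d a > 0"
    using interior[of w] w_\<theta> \<open>w \<noteq> 0\<close> d by (metis neg_0_less_iff_less not_le_imp_less)
  obtain b where b: "b \<in> {1..m}" "d b < 0"
    using interior[of "- w"] w_\<theta> \<open>w \<noteq> 0\<close> d
    by (metis inner_minus_left neg_equal_0_iff_equal not_le_imp_less)
  obtain s where s: "(\<Sum>i=1..m. d i * exp (d i * s)) = 0"
    using exists_critical_point[of "{1..m}" a d b] a b by auto
  \<comment> \<open>Up to a common factor the weights become \<open>exp (d i * s)\<close>, so the
    choice of \<open>s\<close> makes the mean \<mu> orthogonal to \<open>w\<close>, just as \<theta>
    is.\<close>
  define u0 where "u0 = - s *\<^sub>R perp \<eta>"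
  define u where "u = u0 + ln (partition_sum m X u0) *\<^sub>R \<eta>"
  define q where "q = (\<lambda>i. exp (- (u \<bullet> X i)))"
  define \<mu> where "\<mu> = (\<Sum>i=1..m. q i *\<^sub>R X i)"
  have P: "partition_sum m X u = 1"
    unfolding u_def by (rule partition_sum_normalise[OF m cop])
  then have q_sum: "(\<Sum>i=1..m. q i) = 1"
    by (simp add: partition_sum_def q_def)
  have q_eq: "q i = exp (s * \<kappa> - ln (partition_sum m X u0)) * exp (d i * s)" if "i \<in> {1..m}" for i
    using cop'[OF that]
    by (simp add: q_def u_def u0_def inner_add_left inner_perp d_def mult_exp_exp algebra_simps)
  have "(\<Sum>i=1..m. q i * d i) = (\<Sum>i=1..m. exp (s * \<kappa> - ln (partition_sum m X u0)) * (d i * exp (d i * s)))"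
    by (intro sum.cong refl) (simp add: q_eq)
  also have "\<dots> = 0"
    unfolding sum_distrib_left[symmetric] s by simp
  finally have "w \<bullet> \<mu> = 0"
    by (simp add: \<mu>_def inner_sum_right d sum_negf)
  moreover have \<eta>\<mu>: "\<eta> \<bullet> \<mu> = 1"
    using q_sum cop' by (simp add: \<mu>_def inner_sum_right)
  ultimately have "det2 \<eta> \<mu> = \<kappa>"
    by (simp add: w_inner)
  have "\<theta> - (\<eta> \<bullet> \<theta>) *\<^sub>R \<mu> = 0"
  proof -
    define v where "v = \<theta> - (\<eta> \<bullet> \<theta>) *\<^sub>R \<mu>"
    have "\<eta> \<bullet> v = 0"
      by (simp add: v_def inner_diff_right \<eta>\<mu>)
    moreover have "perp \<eta> \<bullet> v = 0"
      using \<theta> by (simp add: v_def inner_diff_right inner_perp \<open>det2 \<eta> \<mu> = \<kappa>\<close> \<kappa>_def)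
    moreover have "(\<eta> \<bullet> \<eta>) * (v \<bullet> v) = (\<eta> \<bullet> v)\<^sup>2 + (perp \<eta> \<bullet> v)\<^sup>2"
      by (simp add: inner_2 perp_def) algebra
    ultimately show ?thesis
      using \<open>\<eta> \<noteq> 0\<close> by (simp add: v_def)
  qed
  then show thesis
    using that[OF P] by (simp add: \<mu>_def q_def)
qed

text \<open>\<theta> is a nonnegative multiple of minus the gradient of the partition sum at
  \<open>u\<close>. The inequality is the tangent bound for this convex function, obtained termwise
  from \<open>exp x \<ge> 1 + x\<close>.\<close>

lemma gibbs_minimises:
  assumes u: "partition_sum m X u = 1" and v: "partition_sum m X v \<le> 1" and c: "c \<ge> 0"
    and \<theta>: "\<theta> = c *\<^sub>R (\<Sum>i=1..m. exp (- (u \<bullet> X i)) *\<^sub>R X i)"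
  shows "u \<bullet> \<theta> \<le> v \<bullet> \<theta>"
proof -
  have "(\<Sum>i=1..m. exp (- (u \<bullet> X i)) * ((u - v) \<bullet> X i))
      \<le> (\<Sum>i=1..m. exp (- (v \<bullet> X i)) - exp (- (u \<bullet> X i)))"
  proof (rule sum_mono)
    fix i
    have "exp (- (u \<bullet> X i)) * (1 + (u - v) \<bullet> X i) \<le> exp (- (u \<bullet> X i)) * exp ((u - v) \<bullet> X i)"
      by (intro mult_left_mono exp_ge_add_one_self) simp
    also have "\<dots> = exp (- (v \<bullet> X i))"
      by (simp add: mult_exp_exp inner_diff_left)
    finally show "exp (- (u \<bullet> X i)) * ((u - v) \<bullet> X i) \<le> exp (- (v \<bullet> X i)) - exp (- (u \<bullet> X i))"
      by (simp add: algebra_simps)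
  qed
  also have "\<dots> \<le> 0"
    using u v by (simp add: sum_subtractf partition_sum_def)
  finally have "c * (\<Sum>i=1..m. exp (- (u \<bullet> X i)) * ((u - v) \<bullet> X i)) \<le> 0"
    using c by (simp add: mult_nonneg_nonpos)
  then have "(u - v) \<bullet> \<theta> \<le> 0"
    by (simp add: \<theta> inner_sum_right)
  then show ?thesis
    by (simp add: inner_diff_left)
qed

text \<open>If the sum for \<open>Y\<close> exceeded 1 at \<open>u\<close>, moving \<open>u\<close>
  along \<eta>' onto the level curve of \<open>Y\<close> would strictly increase its pairing with
  the Gibbs direction \<theta> of the new point. That pairing is the growth of \<open>Y\<close> at
  \<theta>, while minimality bounds the growth of \<open>X\<close> there by
  \<open>u \<bullet> \<theta>\<close>.\<close>

lemma partition_sum_le_1_transfer: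
  assumes X: "m \<ge> 1" "integral_family m X" "coplanar_family \<eta> m X"
    and Y: "m' \<ge> 1" "integral_family m' Y" "span (Y ` {1..m'}) = UNIV" "coplanar_family \<eta>' m' Y"
    and cone: "family_cone m X = family_cone m' Y"
    and growth: "\<forall>\<theta>\<in>family_cone m X. norm \<theta> = 1 \<longrightarrow>
           directional_growth m X \<theta> = directional_growth m' Y \<theta>"
    and u: "partition_sum m X u \<le> 1"
  shows "partition_sum m' Y u \<le> 1"
proof (rule ccontr)
  assume gt: "\<not> ?thesis"
  define u' where "u' = u + ln (partition_sum m' Y u) *\<^sub>R \<eta>'"
  have u': "partition_sum m' Y u' = 1"
    unfolding u'_def by (rule partition_sum_normalise[OF Y(1,4)])
  define q where "q = (\<lambda>i. exp (- (u' \<bullet> Y i)))"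
  define \<mu> where "\<mu> = (\<Sum>i=1..m'. q i *\<^sub>R Y i)"
  define \<theta> where "\<theta> = (1 / norm \<mu>) *\<^sub>R \<mu>"
  have "\<eta>' \<bullet> \<mu> = (\<Sum>i=1..m'. q i)"
    using Y(4) by (simp add: \<mu>_def inner_sum_right coplanar_family_def)
  then have \<eta>'\<mu>: "\<eta>' \<bullet> \<mu> = 1"
    using u' by (simp add: partition_sum_def q_def)
  then have "\<mu> \<noteq> 0"
    by auto
  then have unit: "norm \<theta> = 1"
    by (simp add: \<theta>_def)
  have \<theta>_sum: "\<theta> = (\<Sum>i=1..m'. (q i / norm \<mu>) *\<^sub>R Y i)"
    by (simp add: \<theta>_def \<mu>_def scaleR_sum_right)
  have "\<theta> \<in> family_cone m' Y"
    unfolding family_cone_def \<theta>_sum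
    by (intro CollectI exI[of _ "\<lambda>i. q i / norm \<mu>"]) (auto simp: q_def)
  then have \<theta>_cone: "\<theta> \<in> family_cone m X"
    by (simp add: cone)
  \<comment> \<open>A functional nonnegative on \<open>X\<close> is nonnegative on the common cone,
    hence on \<open>Y\<close>. Since \<theta> combines the \<open>Y j\<close> with strictly positive
    coefficients, vanishing at \<theta> forces vanishing on every \<open>Y j\<close>.\<close>
  have interior: "w = 0" if w: "\<And>i. i \<in> {1..m} \<Longrightarrow> w \<bullet> X i \<ge> 0" "w \<bullet> \<theta> = 0" for w
  proof (rule inner_eq_0_of_span[OF Y(3)])
    have nonneg: "w \<bullet> Y j \<ge> 0" if "j \<in> {1..m'}" for j
      using family_cone_inner_nonneg[of m w X "Y j"] w(1) mem_family_cone[OF that] cone by blast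
    have "(\<Sum>j=1..m'. (q j / norm \<mu>) * (w \<bullet> Y j)) = 0"
      using w(2) by (simp add: \<theta>_sum inner_sum_right)
    then have "\<forall>j\<in>{1..m'}. (q j / norm \<mu>) * (w \<bullet> Y j) = 0"
      using nonneg by (subst (asm) sum_nonneg_eq_0_iff) (auto simp: q_def)
    then show "w \<bullet> x = 0" if "x \<in> Y ` {1..m'}" for x
      using that \<open>\<mu> \<noteq> 0\<close> by (auto simp: q_def)
  qed
  have "\<eta> \<bullet> X 1 = 1"
    using X(1,3) by (auto simp: coplanar_family_def)
  have "\<eta> \<bullet> \<theta> \<ge> 0"
    by (rule family_cone_inner_nonneg[OF _ \<theta>_cone]) (use X(3) in \<open>auto simp: coplanar_family_def\<close>)
  moreover have "\<eta> \<bullet> \<theta> \<noteq> 0"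
    using interior[of \<eta>] X(3) \<open>\<eta> \<bullet> X 1 = 1\<close> by (auto simp: coplanar_family_def)
  ultimately have \<eta>\<theta>: "\<eta> \<bullet> \<theta> > 0"
    by simp
  obtain v where v: "partition_sum m X v = 1"
    "\<theta> = (\<eta> \<bullet> \<theta>) *\<^sub>R (\<Sum>i=1..m. exp (- (v \<bullet> X i)) *\<^sub>R X i)"
    using exists_gibbs_vector[OF X(1,3) \<eta>\<theta> interior] by blast
  have "directional_growth m X \<theta> = v \<bullet> \<theta>"
    unfolding directional_growth_def using growth_limit[OF X(2,3) v(1) \<eta>\<theta> v(2)] by (rule limI)
  moreover have "directional_growth m' Y \<theta> = u' \<bullet> \<theta>"
    unfolding directional_growth_def
    using growth_limit[OF Y(2,4) u', of "1 / norm \<mu>" \<theta>] \<open>\<mu> \<noteq> 0\<close>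
    by (intro limI) (simp add: \<theta>_def \<mu>_def q_def)
  ultimately have "v \<bullet> \<theta> = u' \<bullet> \<theta>"
    using growth \<theta>_cone unit by simp
  also have "\<dots> = u \<bullet> \<theta> + ln (partition_sum m' Y u) / norm \<mu>"
    by (simp add: u'_def inner_add_left \<theta>_def \<eta>'\<mu> add_divide_distrib)
  also have "\<dots> > u \<bullet> \<theta>"
    using gt \<open>\<mu> \<noteq> 0\<close> by simp
  finally show False
    using gibbs_minimises[OF v(1) u _ v(2)] \<eta>\<theta> by simp
qed

text \<open>At \<open>u - \<eta> / n\<close> the sum for \<open>X\<close> is
  \<open>exp (1 / n) > 1\<close>, so the sum for \<open>Y\<close> exceeds 1 there as well;
  continuity gives the missing inequality at \<open>u\<close>.\<close>

lemma partition_sum_eq_1_transfer: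
  assumes copX: "coplanar_family \<eta> m X"
    and transfer: "\<And>u. partition_sum m X u \<le> 1 \<longleftrightarrow> partition_sum m' Y u \<le> 1"
    and u: "partition_sum m X u = 1"
  shows "partition_sum m' Y u = 1"
proof (rule antisym)
  show "partition_sum m' Y u \<le> 1"
    using transfer[of u] u by simp
  have "(\<lambda>n. partition_sum m' Y (u + (- (1 / real n)) *\<^sub>R \<eta>)) \<longlonglongrightarrow> partition_sum m' Y (u + (- 0) *\<^sub>R \<eta>)"
    unfolding partition_sum_def by (intro tendsto_intros lim_1_over_n)
  moreover have "partition_sum m' Y (u + (- (1 / real n)) *\<^sub>R \<eta>) \<ge> 1" if "n > 0" for n
    using transfer[of "u + (- (1 / real n)) *\<^sub>R \<eta>"] partition_sum_shift[OF copX, of u "- (1 / real n)"] u that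
    by simp
  ultimately show "1 \<le> partition_sum m' Y u"
    by (intro LIMSEQ_le_const[of _ _ 1]) (auto intro!: exI[of _ 1])
qed

section \<open>Continuation to a complex root\<close>

text \<open>The index \<open>i0\<close> keeps 0 from being a root of the polynomial and
  \<open>i1\<close> makes it nonconstant, so it has a nonzero root of least modulus. The identity is
  used after multiplication by the largest occurring power of \<open>Q\<close>: at that root one
  side tends to 0 and the other does not.\<close>

lemma no_power_sum_identity:
  fixes a \<alpha> :: "nat \<Rightarrow> nat" and \<beta> :: "nat \<Rightarrow> real" and I J :: "nat set"
  defines "Q \<equiv> \<lambda>t::real. \<Sum>i\<in>I. t ^ a i"
  assumes fin: "finite I" "finite J" and J: "J \<noteq> {}"
    and i0: "i0 \<in> I" "a i0 = 0" and i1: "i1 \<in> I" "a i1 > 0"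
    and pos: "\<And>j. j \<in> J \<Longrightarrow> \<beta> j > 0"
    and inj: "\<And>j k. \<lbrakk>j \<in> J; k \<in> J; \<beta> j = \<beta> k\<rbrakk> \<Longrightarrow> \<alpha> j = \<alpha> k"
    and eq: "\<And>t. t > 0 \<Longrightarrow> (\<Sum>j\<in>J. t ^ \<alpha> j * Q t powr (- \<beta> j)) = 1"
  shows False
proof -
  define q where "q = (\<lambda>z::complex. \<Sum>i\<in>I. z ^ a i)"
  define p :: "complex poly" where "p = (\<Sum>i\<in>I. monom 1 (a i))"
  have poly_p: "poly p z = q z" for z
    by (simp add: p_def q_def poly_sum poly_monom)
  have q_real: "q (of_real t) = of_real (Q t)" for t
    by (simp add: q_def Q_def)
  have Qpos: "Q t > 0" if "t \<ge> 0" for t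
    unfolding Q_def using that i0 fin by (intro sum_pos2[of _ i0]) auto
  have "Q 0 < Q 1"
    unfolding Q_def using fin i1 by (intro sum_strict_mono_ex1) (auto intro!: bexI[of _ i1] simp: power_0_left)
  then have q01: "q 0 \<noteq> q 1"
    using q_real[of 0] q_real[of 1] by simp
  then have "\<not> constant (poly p)"
    by (auto simp: constant_def poly_p)
  then obtain z1 where z1: "q z1 = 0"
    using Fundamental_Theorem_Algebra.fundamental_theorem_of_algebra[of p] by (auto simp: poly_p)
  have "p \<noteq> 0"
    using q01 poly_p[of 0] poly_p[of 1] by auto
  then have finroots: "finite {z. q z = 0}"
    using poly_roots_finite[of p] by (simp add: poly_p)
  define z0 where "z0 = arg_min_on cmod {z. q z = 0}"
  have z0: "q z0 = 0" and z0_min: "\<And>z. q z = 0 \<Longrightarrow> cmod z0 \<le> cmod z"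
    using arg_min_if_finite(1)[OF finroots, of cmod] arg_min_least[OF finroots, of _ cmod] z1
    unfolding z0_def by auto
  have z0_nz: "z0 \<noteq> 0"
    using z0 q_real[of 0] Qpos[of 0] by auto
  define S where "S = ball (0::complex) (cmod z0)"
  have S0: "0 \<in> S" and S: "open S" "connected S" "contractible S"
    using z0_nz by (auto simp: S_def intro: convex_imp_contractible)
  have q_nz: "q z \<noteq> 0" if "z \<in> S" for z
    using that z0_min[of z] by (auto simp: S_def)
  have q_hol: "q holomorphic_on S"
    unfolding q_def by (intro holomorphic_intros)
  obtain g0 where g0: "g0 holomorphic_on S" "\<And>z. z \<in> S \<Longrightarrow> q z = exp (g0 z)"
    using contractible_imp_holomorphic_log[OF q_hol S(3) q_nz] by metis
  \<comment> \<open>The branch of the logarithm is normalised to be real at 0, so that it restricts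
    to \<open>ln (Q t)\<close> for small positive \<open>t\<close>.\<close>
  define g where "g = (\<lambda>z. g0 z - g0 0 + of_real (ln (Q 0)))"
  have g_hol: "g holomorphic_on S"
    unfolding g_def by (intro holomorphic_intros g0)
  have g_exp: "exp (g z) = q z" if "z \<in> S" for z
  proof -
    have "exp (g z) = q z / exp (g0 0) * of_real (Q 0)"
      using g0(2)[OF that] Qpos[of 0]
      by (simp add: g_def exp_add exp_diff exp_of_real)
    also have "exp (g0 0) = of_real (Q 0)"
      using g0(2)[OF S0] q_real[of 0] by simp
    finally show ?thesis
      using Qpos[of 0] by simp
  qed
  have "isCont g 0"
    using holomorphic_on_imp_continuous_on[OF g_hol] S(1) S0 by (simp add: continuous_on_eq_continuous_at)
  moreover have "Im (g 0) = 0"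
    by (simp add: g_def)
  \<comment> \<open>Within this radius the imaginary part of \<open>g\<close> stays below pi in
    modulus, which identifies \<open>g\<close> with the principal logarithm of
    \<open>q\<close>.\<close>
  ultimately obtain \<epsilon> where \<epsilon>: "\<epsilon> > 0" "\<And>z. cmod z < \<epsilon> \<Longrightarrow> cmod (g z - g 0) < pi"
    unfolding continuous_at_eps_delta using pi_gt_zero by (metis dist_norm diff_zero)
  define r where "r = min \<epsilon> (cmod z0)"
  have r: "r > 0"
    using \<epsilon> z0_nz by (simp add: r_def)
  have g_real: "g (of_real t) = of_real (ln (Q t))" if t: "0 < t" "t < r" for t
  proof -
    have tS: "of_real t \<in> S"
      using t by (simp add: S_def r_def)
    have "\<bar>Im (g (of_real t) - g 0)\<bar> < pi"
      using \<epsilon>(2)[of "of_real t"] t abs_Im_le_cmod[of "g (of_real t) - g 0"] by (simp add: r_def)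
    then have "\<bar>Im (g (of_real t))\<bar> < pi"
      using \<open>Im (g 0) = 0\<close> by simp
    then have "g (of_real t) = Ln (exp (g (of_real t)))"
      by (subst Ln_exp) auto
    also have "\<dots> = of_real (ln (Q t))"
      using g_exp[OF tS] Qpos[of t] t by (simp add: q_real Ln_of_real)
    finally show ?thesis .
  qed
  define B where "B = Max (\<beta> ` J)"
  have B: "\<And>j. j \<in> J \<Longrightarrow> \<beta> j \<le> B" and "B \<in> \<beta> ` J"
    unfolding B_def using fin J by auto
  then obtain j0 where j0: "j0 \<in> J" "\<beta> j0 = B"
    by auto
  have B_pos: "B > 0"
    using pos[OF j0(1)] j0 by simp
  \<comment> \<open>The left side of the identity multiplied by \<open>Q powr B\<close>. The
    exponents \<open>B - \<beta> j\<close> are nonnegative and vanish exactly for the maximal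
    \<beta>.\<close>
  define L where "L = (\<lambda>z. \<Sum>j\<in>J. z ^ \<alpha> j * exp (of_real (B - \<beta> j) * g z))"
  have L_eq: "L z = exp (of_real B * g z)" if "z \<in> S" for z
  proof -
    define U where "U = complex_of_real ` {0<..<r}"
    have "L z - exp (of_real B * g z) = 0"
    proof (rule analytic_continuation[where f = "\<lambda>z. L z - exp (of_real B * g z)"])
      show "(\<lambda>z. L z - exp (of_real B * g z)) holomorphic_on S"
        unfolding L_def by (intro holomorphic_intros g_hol)
      show "U \<subseteq> S"
        by (auto simp: U_def S_def r_def)
      show "0 islimpt U"
        unfolding islimpt_approachable
      proof (intro allI impI)
        fix e :: real assume "e > 0"
        define x where "x = min e r / 2"
        have "x \<in> {0<..<r}" "x < e"
          using r \<open>e > 0\<close> by (auto simp: x_def)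
        then show "\<exists>x'\<in>U. x' \<noteq> 0 \<and> dist x' 0 < e"
          by (intro bexI[of _ "of_real x"]) (auto simp: U_def)
      qed
      show "L w - exp (of_real B * g w) = 0" if "w \<in> U" for w
      proof -
        obtain t where t: "w = of_real t" "0 < t" "t < r"
          using \<open>w \<in> U\<close> by (auto simp: U_def)
        have "(\<Sum>j\<in>J. t ^ \<alpha> j * exp ((B - \<beta> j) * ln (Q t)))
            = exp (B * ln (Q t)) * (\<Sum>j\<in>J. t ^ \<alpha> j * Q t powr (- \<beta> j))"
          unfolding sum_distrib_left using Qpos[of t] t
          by (intro sum.cong refl) (simp add: powr_def mult_exp_exp algebra_simps)
        also have "\<dots> = exp (B * ln (Q t))"
          by (simp add: eq t)
        finally have "complex_of_real (\<Sum>j\<in>J. t ^ \<alpha> j * exp ((B - \<beta> j) * ln (Q t)))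
            = complex_of_real (exp (B * ln (Q t)))"
          by simp
        then show ?thesis
          by (simp add: L_def t(1) g_real[OF t(2,3)] exp_of_real flip: of_real_diff of_real_mult of_real_power)
      qed
    qed (use S S0 that in auto)
    then show ?thesis
      by simp
  qed
  \<comment> \<open>A radial approach to \<open>z0\<close> from inside the disc; the shift by 2
    keeps the factor in \<open>[1/2, 1)\<close>.\<close>
  define s where "s = (\<lambda>n. of_real (1 - 1 / real (n + 2)) * z0)"
  have s_S: "s n \<in> S" for n
  proof -
    have "\<bar>1 - 1 / real (n + 2)\<bar> < 1"
      by (simp add: field_simps)
    then show ?thesis
      using z0_nz unfolding S_def s_def norm_mult mem_ball_0 norm_of_real by simp
  qed
  have "(\<lambda>n. 1 - 1 / real (n + 2)) \<longlonglongrightarrow> 1 - 0"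
    by (intro tendsto_diff tendsto_const LIMSEQ_ignore_initial_segment[of "\<lambda>n. 1 / real n"] lim_1_over_n)
  then have "s \<longlonglongrightarrow> of_real 1 * z0"
    unfolding s_def by (intro tendsto_intros) simp
  then have s_lim: "s \<longlonglongrightarrow> z0"
    by simp
  have "(\<lambda>n. q (s n)) \<longlonglongrightarrow> q z0"
    unfolding q_def by (intro tendsto_intros s_lim)
  then have qs_lim: "(\<lambda>n. cmod (q (s n))) \<longlonglongrightarrow> 0"
    using z0 tendsto_norm by force
  have exp_lim: "(\<lambda>n. exp (of_real c * g (s n))) \<longlonglongrightarrow> 0" if "c > 0" for c
  proof (rule tendsto_norm_zero_cancel)
    have "(\<lambda>n. cmod (q (s n)) powr c) \<longlonglongrightarrow> 0"
      using tendsto_powr'[OF qs_lim tendsto_const, of c] that by (simp add: q_nz s_S)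
    moreover have "cmod (exp (of_real c * g (s n))) = cmod (q (s n)) powr c" for n
      using g_exp[OF s_S[of n]] by (simp add: powr_def q_nz s_S flip: g_exp[OF s_S[of n]])
    ultimately show "(\<lambda>n. cmod (exp (of_real c * g (s n)))) \<longlonglongrightarrow> 0"
      by simp
  qed
  have "(\<lambda>n. L (s n)) \<longlonglongrightarrow> (\<Sum>j\<in>J. z0 ^ \<alpha> j * (if \<beta> j = B then 1 else 0))"
    unfolding L_def
  proof (intro tendsto_sum tendsto_mult tendsto_power s_lim)
    fix j assume j: "j \<in> J"
    show "(\<lambda>n. exp (of_real (B - \<beta> j) * g (s n))) \<longlonglongrightarrow> (if \<beta> j = B then 1 else 0)"
      using exp_lim[of "B - \<beta> j"] B[OF j] by auto
  qed
  moreover have "(\<lambda>n. L (s n)) \<longlonglongrightarrow> 0"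
    using exp_lim[OF B_pos] by (simp add: L_eq s_S)
  ultimately have "(\<Sum>j\<in>J. z0 ^ \<alpha> j * (if \<beta> j = B then 1 else 0)) = 0"
    using LIMSEQ_unique by blast
  \<comment> \<open>By \<open>inj\<close> the surviving terms share one exponent, so they add up to
    a positive multiple of a single power of \<open>z0\<close> and cannot cancel.\<close>
  also have "(\<Sum>j\<in>J. z0 ^ \<alpha> j * (if \<beta> j = B then 1 else 0)) =
      (\<Sum>j\<in>J. z0 ^ \<alpha> j0 * (if \<beta> j = B then 1 else 0))"
    using inj[OF _ j0(1)] j0(2) by (intro sum.cong refl) auto
  also have "\<dots> = z0 ^ \<alpha> j0 * of_nat (card {j \<in> J. \<beta> j = B})"
    using fin by (simp add: Int_def flip: sum_distrib_left sum.inter_filter)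
  finally have "card {j \<in> J. \<beta> j = B} = 0"
    using z0_nz by simp
  then show False
    using fin j0 by auto
qed

section \<open>Parallel lines\<close>

lemma det2_nat:
  fixes x y :: "real^2"
  assumes "\<And>j. x $ j \<in> \<int>" "\<And>j. y $ j \<in> \<int>" "det2 x y \<ge> 0"
  shows "real (nat \<lfloor>det2 x y\<rfloor>) = det2 x y"
proof -
  have "det2 x y \<in> \<int>"
    using assms unfolding det2_def by auto
  then show ?thesis
    using assms(3) by simp
qed

text \<open>The Cramer coordinates of all vectors with respect to \<open>X a\<close> and
  \<open>X b\<close> are nonnegative, and integers by integrality of both families. Parametrising
  the level curve of \<open>X\<close> by \<open>t\<close> turns \<open>level\<close> into the
  identity excluded by \<open>no_power_sum_identity\<close>.\<close>

lemma inner_eq_of_partition_sum_eq: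
  assumes intX: "integral_family m X" and copX: "coplanar_family \<eta> m X"
    and Y: "m' \<ge> 1" "integral_family m' Y" "coplanar_family \<eta>' m' Y"
    and cone: "\<And>j. j \<in> {1..m'} \<Longrightarrow> Y j \<in> family_cone m X"
    and ab: "a \<in> {1..m}" "b \<in> {1..m}" and pos: "det2 (X a) (X b) > 0"
    and extreme: "\<And>i. i \<in> {1..m} \<Longrightarrow> det2 (X i) (X b) \<ge> 0" "\<And>i. i \<in> {1..m} \<Longrightarrow> det2 (X a) (X i) \<ge> 0"
    and level: "\<And>u. partition_sum m X u = 1 \<Longrightarrow> partition_sum m' Y u = 1"
  shows "\<eta>' \<bullet> X a = \<eta>' \<bullet> X b"
proof (rule ccontr)
  assume neq: "\<eta>' \<bullet> X a \<noteq> \<eta>' \<bullet> X b"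
  define \<Delta> where "\<Delta> = det2 (X a) (X b)"
  define pa where "pa = (\<lambda>x. det2 x (X b))"
  define pb where "pb = (\<lambda>x. det2 (X a) x)"
  have \<Delta>: "\<Delta> > 0"
    using pos by (simp add: \<Delta>_def)
  have Cramer: "\<Delta> * (w \<bullet> x) = pa x * (w \<bullet> X a) + pb x * (w \<bullet> X b)" for w x
    unfolding \<Delta>_def pa_def pb_def by (rule Cramer2)
  have X_int: "X i $ j \<in> \<int>" if "i \<in> {1..m}" for i j
    using intX that by (auto simp: integral_family_def)
  have Y_int: "Y i $ j \<in> \<int>" if "i \<in> {1..m'}" for i j
    using Y(2) that by (auto simp: integral_family_def)
  have Xab: "pa (X i) + pb (X i) = \<Delta>" if "i \<in> {1..m}" for i
    using Cramer[of \<eta> "X i"] copX ab that by (simp add: coplanar_family_def)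
  have Yab: "pa (Y j) * (\<eta>' \<bullet> X a) + pb (Y j) * (\<eta>' \<bullet> X b) = \<Delta>" if "j \<in> {1..m'}" for j
    using Cramer[of \<eta>' "Y j"] Y(3) that by (simp add: coplanar_family_def)
  have pa_perp: "pa x = - perp (X b) \<bullet> x" and pb_perp: "pb x = perp (X a) \<bullet> x" for x
    by (simp_all add: pa_def pb_def inner_perp det2_commute[of x])
  have Y_pa: "pa (Y j) \<ge> 0" if "j \<in> {1..m'}" for j
    unfolding pa_perp
  proof (rule family_cone_inner_nonneg[OF _ cone[OF that]])
    show "- perp (X b) \<bullet> X i \<ge> 0" if "i \<in> {1..m}" for i
      using extreme(1)[OF that] unfolding pa_perp[symmetric] pa_def .
  qed
  have Y_pb: "pb (Y j) \<ge> 0" if "j \<in> {1..m'}" for j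
    unfolding pb_perp
  proof (rule family_cone_inner_nonneg[OF _ cone[OF that]])
    show "perp (X a) \<bullet> X i \<ge> 0" if "i \<in> {1..m}" for i
      using extreme(2)[OF that] unfolding pb_perp[symmetric] pb_def .
  qed
  define na where "na = (\<lambda>x. nat \<lfloor>pa x\<rfloor>)"
  have na_X: "real (na (X i)) = pa (X i)" if "i \<in> {1..m}" for i
    unfolding na_def pa_def using X_int[OF that] X_int[OF ab(2)] extreme(1)[OF that] by (rule det2_nat)
  have na_Y: "real (na (Y j)) = pa (Y j)" if "j \<in> {1..m'}" for j
    unfolding na_def pa_def using Y_int[OF that] X_int[OF ab(2)] Y_pa[OF that, unfolded pa_def] by (rule det2_nat)
  \<comment> \<open>By Cramer's rule with \<eta> this equals
    \<open>\<eta> \<bullet> Y j\<close>.\<close>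
  define \<beta> where "\<beta> = (\<lambda>j. (pa (Y j) + pb (Y j)) / \<Delta>)"
  show False
  proof (rule no_power_sum_identity[of "{1..m}" "{1..m'}" b "\<lambda>i. na (X i)" a \<beta> "\<lambda>j. na (Y j)"])
    show "na (X b) = 0"
      by (simp add: na_def pa_def)
    show "na (X a) > 0"
      using na_X[OF ab(1)] \<Delta> by (simp add: pa_def \<Delta>_def)
    show "\<beta> j > 0" if "j \<in> {1..m'}" for j
    proof -
      have "pa (Y j) \<noteq> 0 \<or> pb (Y j) \<noteq> 0"
        using Yab[OF that] \<Delta> by auto
      then show ?thesis
        using Y_pa[OF that] Y_pb[OF that] \<Delta> unfolding \<beta>_def by (intro divide_pos_pos) auto
    qed
    show "na (Y j) = na (Y k)" if j: "j \<in> {1..m'}" and k: "k \<in> {1..m'}" and "\<beta> j = \<beta> k" for j k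
    proof -
      have "pa (Y j) + pb (Y j) = pa (Y k) + pb (Y k)"
        using \<open>\<beta> j = \<beta> k\<close> \<Delta> by (simp add: \<beta>_def)
      \<comment> \<open>Equal coordinate sums, together with the relation \<open>Yab\<close> for
        both vectors, leave one linear equation for the difference of the first coordinates.\<close>
      then have "(pa (Y j) - pa (Y k)) * (\<eta>' \<bullet> X a - \<eta>' \<bullet> X b) = 0"
        using Yab[OF j] Yab[OF k] by algebra
      then show ?thesis
        using neq by (simp add: na_def)
    qed
    show "(\<Sum>j\<in>{1..m'}. t ^ na (Y j) * (\<Sum>i\<in>{1..m}. t ^ na (X i)) powr (- \<beta> j)) = 1" if t: "t > 0" for t :: real
    proof -
      define Q where "Q = (\<Sum>i=1..m. t ^ na (X i))"
      have Q: "Q > 0"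
        unfolding Q_def using t ab by (intro sum_pos) auto
      \<comment> \<open>The vector \<open>u\<close> is built to give \<open>X i\<close> the weight
        \<open>t ^ na (X i) / Q\<close>: the coordinates of \<open>X i\<close> sum to \<Delta>, so
        \<open>ly\<close> contributes exactly the factor \<open>1 / Q\<close>.\<close>
      define ly where "ly = - ln Q / \<Delta>"
      define u where "u = (ln t + ly) *\<^sub>R perp (X b) - ly *\<^sub>R perp (X a)"
      have u_inner: "- (u \<bullet> x) = pa x * ln t + (pa x + pb x) * ly" for x
        by (simp add: u_def inner_diff_left pa_perp pb_perp algebra_simps)
      have t_pow: "t ^ n = exp (real n * ln t)" for n
        using t by (simp add: exp_of_nat_mult)
      have "exp (- (u \<bullet> X i)) = t ^ na (X i) / Q" if "i \<in> {1..m}" for i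
        using \<Delta> Q unfolding u_inner Xab[OF that] t_pow na_X[OF that] by (simp add: ly_def exp_diff)
      then have "partition_sum m X u = Q / Q"
        by (simp add: partition_sum_def Q_def flip: sum_divide_distrib)
      then have "partition_sum m' Y u = 1"
        using Q by (intro level) simp
      moreover have "exp (- (u \<bullet> Y j)) = t ^ na (Y j) * Q powr (- \<beta> j)" if "j \<in> {1..m'}" for j
        using \<Delta> Q unfolding u_inner t_pow na_Y[OF that]
        by (simp add: ly_def \<beta>_def powr_def mult_exp_exp)
      ultimately show ?thesis
        by (simp add: partition_sum_def Q_def)
    qed
  qed (use ab Y(1) in auto)
qed

theorem theorem8p5:
  fixes X Y :: "nat \<Rightarrow> real^2" and m m' :: nat and \<eta> \<eta>' :: "real^2"
  assumes "m \<ge> 2" and "integral_family m X" and "span (X ` {1..m}) = UNIV"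
    and "coplanar_family \<eta> m X"
    and "m' \<ge> 2" and "integral_family m' Y" and "span (Y ` {1..m'}) = UNIV"
    and "coplanar_family \<eta>' m' Y"
    and "family_cone m X = family_cone m' Y"
    and "\<forall>\<theta>\<in>family_cone m X. norm \<theta> = 1 \<longrightarrow>
           directional_growth m X \<theta> = directional_growth m' Y \<theta>"
  shows "\<exists>c>0. \<eta> = c *\<^sub>R \<eta>'"
proof -
  have m: "m \<ge> 1" "m' \<ge> 1"
    using assms(1,5) by auto
  have growth': "\<forall>\<theta>\<in>family_cone m' Y. norm \<theta> = 1 \<longrightarrow>
      directional_growth m' Y \<theta> = directional_growth m X \<theta>"
    using assms(9,10) by simp
  have "partition_sum m X u \<le> 1 \<longleftrightarrow> partition_sum m' Y u \<le> 1" for u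
    using partition_sum_le_1_transfer[OF m(1) assms(2,4) m(2) assms(6-10)]
      partition_sum_le_1_transfer[OF m(2) assms(6,8) m(1) assms(2-4) assms(9)[symmetric] growth'] by blast
  then have level: "partition_sum m' Y u = 1" if "partition_sum m X u = 1" for u
    using partition_sum_eq_1_transfer[OF assms(4) _ that] by blast
  have \<eta>X: "\<eta> \<bullet> X i = 1" if "i \<in> {1..m}" for i
    using assms(4) that by (auto simp: coplanar_family_def)
  have "\<eta> \<noteq> 0"
    using \<eta>X[of 1] m by auto
  then have \<eta>\<eta>: "\<eta> \<bullet> \<eta> > 0"
    by simp
  \<comment> \<open>\<open>k\<close> orders the points along their common line; its minimiser and
    maximiser give the two extreme rays of the cone.\<close>
  define k where "k = (\<lambda>i. det2 \<eta> (X i))"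
  define a where "a = arg_min_on k {1..m}"
  define b where "b = arg_min_on (\<lambda>i. - k i) {1..m}"
  have a: "a \<in> {1..m}" "\<And>i. i \<in> {1..m} \<Longrightarrow> k a \<le> k i"
    unfolding a_def using m by (auto intro!: arg_min_if_finite arg_min_least simp del: atLeastAtMost_iff)
  have b: "b \<in> {1..m}" "\<And>i. i \<in> {1..m} \<Longrightarrow> k i \<le> k b"
    using arg_min_if_finite(1)[of "{1..m}" "\<lambda>i. - k i"] arg_min_least[of "{1..m}" _ "\<lambda>i. - k i"] m
    unfolding b_def by (auto simp del: atLeastAtMost_iff)
  have det: "(\<eta> \<bullet> \<eta>) * det2 (X i) (X j) = k j - k i" if "i \<in> {1..m}" "j \<in> {1..m}" for i j
    using det2_via_inner[of \<eta> "X i" "X j"] \<eta>X that by (simp add: k_def)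
  have det_nonneg: "det2 (X i) (X j) \<ge> 0" if "i \<in> {1..m}" "j \<in> {1..m}" "k i \<le> k j" for i j
    using det[OF that(1,2)] that(3) \<eta>\<eta> by (metis diff_ge_0_iff_ge zero_le_mult_iff not_le)
  have "k a \<noteq> k b"
  proof
    assume "k a = k b"
    then have "k i = k a" if "i \<in> {1..m}" for i
      using a b that by (metis antisym)
    \<comment> \<open>If all points coincided, this functional would vanish on the spanning family,
      although its pairing with \<open>perp \<eta>\<close> is nonzero.\<close>
    then have "k a *\<^sub>R \<eta> - perp \<eta> = 0"
      using \<eta>X by (intro inner_eq_0_of_span[OF assms(3)]) (auto simp: inner_diff_left inner_perp k_def)
    then have "(k a *\<^sub>R \<eta> - perp \<eta>) \<bullet> perp \<eta> = 0"
      by simp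
    then show False
      using \<eta>\<eta> by (simp add: inner_diff_left inner_perp)
  qed
  then have "k a < k b"
    using a b by (metis antisym_conv2)
  then have \<Delta>: "det2 (X a) (X b) > 0"
    using det[OF a(1) b(1)] \<eta>\<eta> by (metis diff_gt_0_iff_gt zero_less_mult_pos)
  have Y_cone: "Y j \<in> family_cone m X" if "j \<in> {1..m'}" for j
    using mem_family_cone[OF that] assms(9) by simp
  define e where "e = \<eta>' \<bullet> X a"
  have eq: "\<eta>' \<bullet> X b = e"
    unfolding e_def
    using inner_eq_of_partition_sum_eq[OF assms(2,4) m(2) assms(6,8) Y_cone a(1) b(1) \<Delta> _ _ level]
      det_nonneg a b by simp
  have "\<eta>' - e *\<^sub>R \<eta> = 0"
  proof (rule inner_eq_0_of_span[OF assms(3)])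
    fix x
    have "det2 (X a) (X b) * ((\<eta>' - e *\<^sub>R \<eta>) \<bullet> x) = 0"
      by (subst Cramer2) (use a(1) b(1) eq in \<open>simp add: inner_diff_left \<eta>X e_def\<close>)
    then show "(\<eta>' - e *\<^sub>R \<eta>) \<bullet> x = 0"
      using \<Delta> by simp
  qed
  then have \<eta>': "\<eta>' = e *\<^sub>R \<eta>"
    by simp
  \<comment> \<open>The sign of \<open>e\<close> comes from the common cone: \<eta> is nonnegative
    on it, while \<eta>' equals 1 at \<open>Y 1\<close>.\<close>
  have "\<eta> \<bullet> Y 1 \<ge> 0"
    by (rule family_cone_inner_nonneg[of m _ X]) (use \<eta>X Y_cone[of 1] m in auto)
  moreover have "e * (\<eta> \<bullet> Y 1) = 1"
    using assms(8) m by (simp add: \<eta>' coplanar_family_def)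
  ultimately have "e > 0"
    by (metis mult_nonpos_nonneg not_le not_one_le_zero)
  then show ?thesis
    using \<eta>' by (intro exI[of _ "1 / e"]) simp
qed

end
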